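(* Let $X_0$ and $X=(X_1,X_2,\ldots)$ be (infinitely many) independent indeterminates, and let $u,v$ be further indeterminates. For any integer $n\ge 1$ we have the identity of formal power series in $u,v$ $$\sum_{|\mu|=n}\frac{1}{z_\mu}\prod_{k\ge 1}\left(\sum_{r,s\ge 0}u^r v^s\,\frac{(k)_r}{r!}\,\frac{(k)_s}{s!}\,X_{r+s}\right)^{m_k(\mu)} =\sum_{p,q\ge 0}u^p v^q\left(\sum_{k=0}^{\min(n,p+q)}\binom{X_0+n-1}{n-k}\,P_{p+q,p,k}(X)\right),$$ where the sum on the left is over all partitions $\mu$ of $n$.
   Context: A partition $\mu=(\mu_1,\ldots,\mu_l)$ is a finite weakly decreasing sequence of positive integers; $l(\mu)=l$ is its length, $|\mu|=\sum_i\mu_i$ its weight, $m_i(\mu)$ the number of parts equal to $i$, and $z_\mu=\prod_{i\ge1} i^{m_i(\mu)}m_i(\mu)!$. Write $(a)_n=a(a+1)\cdots(a+n-1)$ and $\binom{a}{n}=a(a-1)\cdots(a-n+1)/n!$ for $n\ge 0$ (also when $a$ is an indeterminate); $\binom{a}{n}=0$ for $n<0$. For integers $n,p,k$ with $n\ge 1$, $k\ge1$, $0\le p\le n$ define $$\binom{n}{p}_{k}=\frac{n}{k}\sum_{r\ge0}\binom{p}{r}\binom{n-p}{r}\binom{n-r-1}{k-r-1},$$ which is $0$ for $k>n$. For a nonempty partition $\mu$ and integers $0\le p\le|\mu|$, $k\ge1$ define $$\genfrac{\langle}{\rangle}{0pt}{}{\mu}{p}_{k}=\sum_{(p_i)}\sum_{(k_i)}\prod_{i=1}^{l(\mu)}\binom{\mu_i}{p_i}_{k_i},$$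 the sum being over all decompositions $p=\sum_{i=1}^{l(\mu)}p_i$, $k=\sum_{i=1}^{l(\mu)}k_i$ with $0\le p_i\le\mu_i$ and $k_i\ge 1$ for all $i$. For $n\ge1$, $k\ge1$, $0\le p\le n$ define the polynomial $$P_{npk}(X)=\sum_{|\mu|=n}\frac{1}{z_\mu}\genfrac{\langle}{\rangle}{0pt}{}{\mu}{p}_{k}\prod_{i\ge1}X_i^{m_i(\mu)}.$$ For $k=0$, $P_{np0}(X)=0$ with the only exception $P_{000}(X)=1$. *)

theory Defs
  imports
    "HOL-Library.Poly_Mapping"
    "HOL-Computational_Algebra.Formal_Power_Series"
begin

definition partitions_of :: "nat \<Rightarrow> nat list set" where
  "partitions_of n = {\<mu>. sorted_wrt (\<ge>) \<mu> \<and> (\<forall>x\<in>set \<mu>. 1 \<le> x) \<and> sum_list \<mu> = n}"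

text \<open>The multiplicity \<open>m\<^sub>i(\<mu>)\<close> is \<open>count_list \<mu> i\<close>. A product over all \<open>i \<ge> 1\<close> of terms
  that are trivial when \<open>m\<^sub>i(\<mu>) = 0\<close> is taken over \<open>1 \<le> i \<le> |\<mu>|\<close>, since no part exceeds \<open>|\<mu>|\<close>.\<close>

definition z_part :: "nat list \<Rightarrow> rat" where
  "z_part \<mu> = (\<Prod>i = 1..sum_list \<mu>. of_nat i ^ count_list \<mu> i * fact (count_list \<mu> i))"

text \<open>The sums over partitions and over decompositions below are over finite sets.\<close>

lemma finite_lists_sum_eq: "finite {xs :: nat list. length xs = l \<and> sum_list xs = m}"
  by (rule finite_subset[OF _ finite_lists_length_eq[of "{..m}" l]])
     (auto intro: member_le_sum_list)

lemma finite_partitions_of: "finite (partitions_of n)"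
proof (rule finite_subset)
  have "length \<mu> \<le> sum_list \<mu>" if "\<forall>x\<in>set \<mu>. 1 \<le> x" for \<mu> :: "nat list"
    using that by (induction \<mu>) auto
  then show "partitions_of n \<subseteq> {\<mu>. set \<mu> \<subseteq> {..n} \<and> length \<mu> \<le> n}"
    by (auto simp: partitions_of_def intro: member_le_sum_list)
  show "finite {\<mu> :: nat list. set \<mu> \<subseteq> {..n} \<and> length \<mu> \<le> n}"
    by (rule finite_lists_length_le) simp
qed

text \<open>For \<open>r \<ge> k\<close> the binomial coefficient with lower entry \<open>k - r - 1 < 0\<close> vanishes by convention,
  so the sum stops at \<open>r < k\<close>. The truncated subtraction in \<open>n - r - 1\<close> has no effect when
  \<open>n \<ge> 1\<close> and \<open>p \<le> n\<close>: then \<open>r \<ge> n\<close> implies that \<open>p choose r\<close> or \<open>(n - p) choose r\<close> is \<open>0\<close>.\<close>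

definition nbinom :: "nat \<Rightarrow> nat \<Rightarrow> nat \<Rightarrow> rat" where
  "nbinom n p k = of_nat n / of_nat k *
     (\<Sum>r<k. of_nat ((p choose r) * ((n - p) choose r) * ((n - r - 1) choose (k - r - 1))))"

definition subweights :: "nat list \<Rightarrow> nat \<Rightarrow> nat list set" where
  "subweights \<mu> p =
     {ps. length ps = length \<mu> \<and> sum_list ps = p \<and> (\<forall>i<length \<mu>. ps ! i \<le> \<mu> ! i)}"

definition compositions :: "nat \<Rightarrow> nat \<Rightarrow> nat list set" where
  "compositions l k = {ks. length ks = l \<and> sum_list ks = k \<and> (\<forall>i<l. 1 \<le> ks ! i)}"

lemma finite_subweights: "finite (subweights \<mu> p)"
  by (rule finite_subset[OF _ finite_lists_sum_eq[of "length \<mu>" p]]) (auto simp: subweights_def)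

lemma finite_compositions: "finite (compositions l k)"
  by (rule finite_subset[OF _ finite_lists_sum_eq[of l k]]) (auto simp: compositions_def)

definition pbinom :: "nat list \<Rightarrow> nat \<Rightarrow> nat \<Rightarrow> rat" where
  "pbinom \<mu> p k =
     (\<Sum>ps\<in>subweights \<mu> p. \<Sum>ks\<in>compositions (length \<mu>) k.
        \<Prod>i<length \<mu>. nbinom (\<mu> ! i) (ps ! i) (ks ! i))"

text \<open>The ring \<open>\<rat>[X\<^sub>0, X\<^sub>1, X\<^sub>2, \<dots>]\<close>: a monomial is its finitely supported exponent function,
  a polynomial a finitely supported function from monomials to coefficients. Multiplication
  of such functions is convolution.\<close>

type_synonym qpoly = "(nat \<Rightarrow>\<^sub>0 nat) \<Rightarrow>\<^sub>0 rat"

definition Con :: "rat \<Rightarrow> qpoly" where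
  "Con c = Poly_Mapping.single 0 c"

definition Ind :: "nat \<Rightarrow> qpoly" where
  "Ind i = Poly_Mapping.single (Poly_Mapping.single i 1) 1"

text \<open>The library's \<open>gchoose\<close> needs a division on the ring, which \<^typ>\<open>qpoly\<close> does not have.\<close>

definition poly_choose :: "qpoly \<Rightarrow> nat \<Rightarrow> qpoly" where
  "poly_choose a m = Con (1 / fact m) * (\<Prod>i<m. a - of_nat i)"

definition Ppoly :: "nat \<Rightarrow> nat \<Rightarrow> nat \<Rightarrow> qpoly" where
  "Ppoly n p k =
     (if k = 0 then (if n = 0 \<and> p = 0 then 1 else 0)
      else \<Sum>\<mu>\<in>partitions_of n. Con (1 / z_part \<mu> * pbinom \<mu> p k) *
             (\<Prod>i = 1..n. Ind i ^ count_list \<mu> i))"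

text \<open>\<open>R[[u, v]]\<close> is rendered as \<open>R[[v]][[u]]\<close>; \<open>series2 f\<close> is
  \<open>\<Sum>r,s\<ge>0. u\<^sup>r v\<^sup>s f(r, s)\<close>. The ring operations of \<open>fps\<close> are the usual Cauchy ones.\<close>

definition series2 :: "(nat \<Rightarrow> nat \<Rightarrow> 'a) \<Rightarrow> 'a fps fps" where
  "series2 f = Abs_fps (\<lambda>r. Abs_fps (\<lambda>s. f r s))"

definition const2 :: "'a::zero \<Rightarrow> 'a fps fps" where
  "const2 c = fps_const (fps_const c)"

end

theory Submission
  imports Defs "HOL-Library.Multiset"
begin

text \<open>
  For a sequence \<open>a\<close> in a \<open>\<rat>\<close>-algebra let \<open>h\<^sub>n(a)\<close> be the sum over the partitions of \<open>n\<close> of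
  \<open>1 / z\<^sub>\<mu>\<close> times the product of the \<open>a\<close> at the parts of \<open>\<mu>\<close>; formally
  \<open>\<Sum>\<^sub>n h\<^sub>n(a) t\<^sup>n = exp (\<Sum>\<^sub>k a\<^sub>k t\<^sup>k / k)\<close>. Both sides of the theorem are such exponentials.

  On the left \<open>a\<^sub>k = S\<^sub>k\<close> is the inner double series. On the right the generating function over \<open>n\<close> is
  \<open>(1 - t) powr (-X\<^sub>0)\<close> times \<open>Q(y) = \<Sum> y\<^sup>k u\<^sup>p v\<^sup>q P\<^bsub>p+q,p,k\<^esub>\<close> at \<open>y = t / (1 - t)\<close>, because
  \<open>\<Sum>\<^sub>n ((X\<^sub>0 + n - 1) choose (n - k)) t\<^sup>n = y\<^sup>k (1 - t) powr (-X\<^sub>0)\<close>, and by the definition of the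
  polynomials \<open>Q = exp (\<Sum>\<^sub>m X\<^sub>m / m \<Sum>\<^sub>p\<^sub>,\<^sub>k u\<^sup>p v\<^bsup>m-p\<^esup> y\<^sup>k nbinom m p k)\<close>. The factor
  \<open>(1 - t) powr (-X\<^sub>0) = exp (X\<^sub>0 \<Sum>\<^sub>k t\<^sup>k / k)\<close> accounts for the index \<open>r = s = 0\<close> in \<open>S\<^sub>k\<close>. Comparing
  the coefficients of \<open>X\<^bsub>r+s\<^esub> u\<^sup>r v\<^sup>s t\<^sup>K\<close> in the exponents and multiplying by \<open>K\<close>
  leaves, for \<open>r + s \<ge> 1\<close>, the numerical identity
  \<open>\<Sum>\<^sub>j j / (r + s) nbinom (r + s) r j (K choose j) = ((K + r - 1) choose r) ((K + s - 1) choose s)\<close>,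
  which is \<open>sum_nbinom_choose\<close>; Vandermonde's convolution, applied several times, proves it.

  The formal proof replaces exponentials by logarithmic derivatives. The elements \<open>h\<^sub>n(a)\<close> are
  characterised by \<open>n h\<^sub>n = \<Sum>\<^sub>k a\<^sub>k h\<^bsub>n-k\<^esub>\<close> (\<open>cycle_index_unique\<close>), so it suffices that the right-hand
  side satisfies this recurrence with \<open>a = S\<close> (\<open>coeff_series_euler\<close>). That follows from a differential
  equation for the series \<open>y\<^sup>k (1 - t) powr (-X\<^sub>0)\<close> (\<open>choose_series_euler\<close>) and a recurrence for the
  polynomials \<open>P\<close> (\<open>Ppoly_recurrence\<close>). The latter comes from applying the derivation \<open>y d/dy\<close> to
  the polynomials, which are themselves a cycle index (\<open>cycle_index_derivation\<close>, \<open>cycle_index_part_series\<close>).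
\<close>

unbundle fps_syntax

section \<open>Cycle index sums over partitions\<close>

text \<open>Partitions as multisets of parts: adding or removing a part is then a plain multiset operation,
  whereas on weakly decreasing lists it would involve sorting.\<close>
definition mset_parts :: "nat \<Rightarrow> nat multiset set" where
  "mset_parts n = {M. 0 \<notin># M \<and> \<Sum>\<^sub># M = n}"

definition z_mset :: "nat multiset \<Rightarrow> rat" where
  "z_mset M = (\<Prod>i\<in>set_mset M. of_nat i ^ count M i * fact (count M i))"

lemma le_of_mem_mset_parts: "M \<in> mset_parts n \<Longrightarrow> i \<in># M \<Longrightarrow> 1 \<le> i \<and> i \<le> n"
  by (auto simp: mset_parts_def dest!: multi_member_split)

lemma bij_betw_mset_partitions: "bij_betw mset (partitions_of n) (mset_parts n)"
proof (rule bij_betwI[where g = "\<lambda>M. rev (sorted_list_of_multiset M)"])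
  show "mset \<in> partitions_of n \<rightarrow> mset_parts n"
    by (auto simp: partitions_of_def mset_parts_def sum_mset_sum_list)
  show "(\<lambda>M. rev (sorted_list_of_multiset M)) \<in> mset_parts n \<rightarrow> partitions_of n"
    by (auto simp: partitions_of_def mset_parts_def sum_mset_sum_list[symmetric] sorted_wrt_rev
        Suc_le_eq intro: gr0I)
  show "rev (sorted_list_of_multiset (mset \<mu>)) = \<mu>" if "\<mu> \<in> partitions_of n" for \<mu>
  proof -
    have "sorted (rev \<mu>)"
      using that by (simp add: partitions_of_def sorted_wrt_rev)
    then have "sort \<mu> = rev \<mu>"
      by (metis mset_rev properties_for_sort)
    then show ?thesis
      by simp
  qed
qed auto

lemma finite_mset_parts: "finite (mset_parts n)"
  using bij_betw_finite[OF bij_betw_mset_partitions] finite_partitions_of by blast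

lemma z_mset_superset:
  assumes "finite A" "set_mset M \<subseteq> A"
  shows "z_mset M = (\<Prod>i\<in>A. of_nat i ^ count M i * fact (count M i))"
  unfolding z_mset_def using assms
  by (intro prod.mono_neutral_left) (auto simp: not_in_iff)

text \<open>This is the reason why the weights \<open>1 / z\<^sub>\<mu>\<close> turn into exponentials: marking one of the equal
  parts \<open>k\<close> of a partition and removing it divides \<open>z\<close> by \<open>k\<close> times the number of choices.\<close>
lemma z_mset_add: "z_mset (add_mset k M) = of_nat k * of_nat (Suc (count M k)) * z_mset M"
proof -
  define A where "A = insert k (set_mset M)"
  have A: "finite A" "k \<in> A"
    by (auto simp: A_def)
  have "z_mset (add_mset k M) = (\<Prod>i\<in>A. of_nat i ^ count (add_mset k M) i * fact (count (add_mset k M) i))"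
    by (rule z_mset_superset) (auto simp: A_def)
  also have "\<dots> = of_nat k ^ Suc (count M k) * fact (Suc (count M k)) *
      (\<Prod>i\<in>A - {k}. of_nat i ^ count M i * fact (count M i))"
    using A by (subst prod.remove[of A k]) auto
  also have "\<dots> = of_nat k * of_nat (Suc (count M k)) *
      (\<Prod>i\<in>A. of_nat i ^ count M i * fact (count M i))"
    using prod.remove[OF A, of "\<lambda>i. of_nat i ^ count M i * fact (count M i) :: rat"] by (simp add: algebra_simps)
  also have "(\<Prod>i\<in>A. of_nat i ^ count M i * fact (count M i)) = z_mset M"
    by (rule z_mset_superset[symmetric]) (auto simp: A_def)
  finally show ?thesis .
qed

lemma z_part_eq_z_mset: "\<mu> \<in> partitions_of n \<Longrightarrow> z_part \<mu> = z_mset (mset \<mu>)"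
  unfolding z_part_def
  by (subst z_mset_superset[of "{1..sum_list \<mu>}"])
     (auto simp: partitions_of_def count_mset intro: member_le_sum_list)

lemma prod_mset_superset:
  fixes f :: "'b \<Rightarrow> 'a :: comm_monoid_mult"
  assumes "finite A" "set_mset M \<subseteq> A"
  shows "(\<Prod>i\<in>#M. f i) = (\<Prod>i\<in>A. f i ^ count M i)"
  using assms
proof (induction M)
  case (add x M)
  have "(\<Prod>i\<in>A. f i ^ count (add_mset x M) i) = (\<Prod>i\<in>A. (if i = x then f i else 1) * f i ^ count M i)"
    by (intro prod.cong) auto
  also have "\<dots> = f x * (\<Prod>i\<in>A. f i ^ count M i)"
    using add.prems by (simp add: prod.distrib prod.delta)
  finally show ?case
    using add by simp
qed auto

lemma sum_mset_superset:
  fixes f :: "'b \<Rightarrow> 'a :: comm_semiring_1"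
  assumes "finite A" "set_mset M \<subseteq> A"
  shows "(\<Sum>i\<in>#M. f i) = (\<Sum>i\<in>A. of_nat (count M i) * f i)"
  using assms
proof (induction M)
  case (add x M)
  have "(\<Sum>i\<in>A. of_nat (count (add_mset x M) i) * f i) =
      (\<Sum>i\<in>A. (if i = x then f i else 0) + of_nat (count M i) * f i)"
    by (intro sum.cong) (auto simp: algebra_simps)
  also have "\<dots> = f x + (\<Sum>i\<in>A. of_nat (count M i) * f i)"
    using add.prems by (simp add: sum.distrib sum.delta)
  finally show ?case
    using add by simp
qed auto

text \<open>A commutative \<open>\<rat>\<close>-algebra, given by its structure map \<open>c\<close>.\<close>
locale rat_algebra =
  fixes c :: "rat \<Rightarrow> 'a :: comm_ring_1"
  assumes c_1: "c 1 = 1"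
    and c_add: "c (x + y) = c x + c y"
    and c_mult: "c (x * y) = c x * c y"
begin

lemma c_0: "c 0 = 0"
  using c_add[of 0 0] by simp

lemma c_of_nat: "c (of_nat n) = of_nat n"
  by (induction n) (simp_all add: c_0 c_1 c_add)

lemma c_inverse: "n > 0 \<Longrightarrow> c (1 / of_nat n) * of_nat n = 1"
  by (simp flip: c_of_nat c_mult add: c_1)

text \<open>For indeterminates \<open>a\<close> this is the cycle index polynomial of the symmetric group on \<open>n\<close> letters;
  for power sums \<open>a\<close> it is the complete symmetric function \<open>h\<^sub>n\<close>.\<close>
definition cycle_index :: "(nat \<Rightarrow> 'a) \<Rightarrow> nat \<Rightarrow> 'a" where
  "cycle_index a n =
     (\<Sum>\<mu>\<in>partitions_of n. c (1 / z_part \<mu>) * (\<Prod>k = 1..n. a k ^ count_list \<mu> k))"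

lemma cycle_index_mset:
  "cycle_index a n = (\<Sum>M\<in>mset_parts n. c (1 / z_mset M) * (\<Prod>i\<in>#M. a i))"
proof -
  have "cycle_index a n = (\<Sum>\<mu>\<in>partitions_of n. c (1 / z_mset (mset \<mu>)) * (\<Prod>i\<in>#mset \<mu>. a i))"
    unfolding cycle_index_def
  proof (rule sum.cong[OF refl])
    fix \<mu> assume \<mu>: "\<mu> \<in> partitions_of n"
    have "mset \<mu> \<in> mset_parts n"
      using \<mu> bij_betw_mset_partitions by (auto simp: bij_betw_def)
    then have "set_mset (mset \<mu>) \<subseteq> {1..n}"
      using le_of_mem_mset_parts by (metis atLeastAtMost_iff subsetI)
    then show "c (1 / z_part \<mu>) * (\<Prod>k = 1..n. a k ^ count_list \<mu> k) =
        c (1 / z_mset (mset \<mu>)) * (\<Prod>i\<in>#mset \<mu>. a i)"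
      by (subst prod_mset_superset[of "{1..n}"]) (simp_all add: z_part_eq_z_mset[OF \<mu>] count_mset)
  qed
  also have "\<dots> = (\<Sum>M\<in>mset_parts n. c (1 / z_mset M) * (\<Prod>i\<in>#M. a i))"
    by (rule sum.reindex_bij_betw[OF bij_betw_mset_partitions])
  finally show ?thesis .
qed

lemma cycle_index_0: "cycle_index a 0 = 1"
proof -
  have "mset_parts 0 = {{#}}"
    by (auto simp: mset_parts_def) (metis multiset_nonemptyE)
  then show ?thesis
    by (simp add: cycle_index_mset z_mset_def c_1)
qed

text \<open>Marking a part \<open>k\<close> of a partition and taking it out is a bijection onto the partitions of
  \<open>n - k\<close>, and by \<open>z_mset_add\<close> the weights differ by the factor \<open>1 / k\<close>. The weights \<open>\<phi>\<close> of the marked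
  part are left open: \<open>\<phi> k = k a\<^sub>k\<close> gives Newton's recurrence, \<open>\<phi> k = D a\<^sub>k\<close> the action of a
  derivation \<open>D\<close>.\<close>
lemma sum_marked_parts:
  "(\<Sum>M\<in>mset_parts n. c (1 / z_mset M) * (\<Sum>k=1..n. of_nat (count M k) * (\<phi> k * (\<Prod>i\<in>#M - {#k#}. a i)))) =
   (\<Sum>k=1..n. c (1 / of_nat k) * \<phi> k * cycle_index a (n - k))"
proof -
  have remove: "(\<Sum>M\<in>mset_parts n. c (1 / z_mset M) * (of_nat (count M k) * (\<phi> k * (\<Prod>i\<in>#M - {#k#}. a i)))) =
      c (1 / of_nat k) * \<phi> k * cycle_index a (n - k)" (is "(\<Sum>M\<in>_. ?t M) = _") if k: "k \<in> {1..n}" for k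
  proof -
    have "(\<Sum>M\<in>mset_parts n. ?t M) = (\<Sum>M\<in>{M\<in>mset_parts n. k \<in># M}. ?t M)"
      by (rule sum.mono_neutral_right) (auto simp: finite_mset_parts not_in_iff)
    also have "\<dots> = (\<Sum>M\<in>mset_parts (n - k). ?t (add_mset k M))"
      by (rule sum.reindex_bij_witness[where i = "add_mset k" and j = "\<lambda>M. M - {#k#}"])
         (use k in \<open>auto simp: mset_parts_def sum_mset_diff dest: in_diffD\<close>)
    also have "\<dots> = (\<Sum>M\<in>mset_parts (n - k). c (1 / of_nat k) * \<phi> k * (c (1 / z_mset M) * (\<Prod>i\<in>#M. a i)))"
    proof (rule sum.cong[OF refl])
      fix M
      have "c (1 / z_mset (add_mset k M)) * of_nat (Suc (count M k)) = c (1 / of_nat k) * c (1 / z_mset M)"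
        by (simp flip: c_mult c_of_nat add: z_mset_add divide_simps del: of_nat_Suc)
      then show "?t (add_mset k M) = c (1 / of_nat k) * \<phi> k * (c (1 / z_mset M) * (\<Prod>i\<in>#M. a i))"
        by (simp add: mult_ac del: of_nat_Suc)
    qed
    also have "\<dots> = c (1 / of_nat k) * \<phi> k * cycle_index a (n - k)"
      by (simp add: cycle_index_mset sum_distrib_left)
    finally show ?thesis .
  qed
  show ?thesis
    unfolding sum_distrib_left by (subst sum.swap) (rule sum.cong[OF refl remove])
qed

text \<open>Newton's identity: \<open>n\<close> is the sum of its parts, so multiplication by \<open>n\<close> marks one
  part \<open>k\<close> with weight \<open>k\<close>.\<close>
lemma cycle_index_recurrence:
  "of_nat n * cycle_index a n = (\<Sum>k=1..n. a k * cycle_index a (n - k))"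
proof -
  have weight: "of_nat n * (\<Prod>i\<in>#M. a i) =
      (\<Sum>k=1..n. of_nat (count M k) * (of_nat k * a k * (\<Prod>i\<in>#M - {#k#}. a i)))"
    if M: "M \<in> mset_parts n" for M
  proof -
    have "n = (\<Sum>k=1..n. count M k * k)"
      using M sum_mset_superset[of "{1..n}" M "\<lambda>k. k"] le_of_mem_mset_parts[OF M]
      by (simp add: mset_parts_def subset_iff)
    then have "of_nat n = (\<Sum>k=1..n. of_nat (count M k) * of_nat k :: 'a)"
      by (metis (mono_tags, lifting) of_nat_mult of_nat_sum sum.cong)
    then have "of_nat n * (\<Prod>i\<in>#M. a i) = (\<Sum>k=1..n. of_nat (count M k) * of_nat k * (\<Prod>i\<in>#M. a i))"
      by (simp add: sum_distrib_right)
    also have "\<dots> = (\<Sum>k=1..n. of_nat (count M k) * (of_nat k * a k * (\<Prod>i\<in>#M - {#k#}. a i)))"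
    proof (rule sum.cong[OF refl])
      fix k
      show "of_nat (count M k) * of_nat k * (\<Prod>i\<in>#M. a i) =
          of_nat (count M k) * (of_nat k * a k * (\<Prod>i\<in>#M - {#k#}. a i))"
        by (cases "k \<in># M") (auto simp: not_in_iff mult_ac dest!: multi_member_split)
    qed
    finally show ?thesis .
  qed
  have "of_nat n * cycle_index a n =
      (\<Sum>M\<in>mset_parts n. c (1 / z_mset M) * (of_nat n * (\<Prod>i\<in>#M. a i)))"
    by (simp add: cycle_index_mset sum_distrib_left mult.left_commute)
  also have "\<dots> = (\<Sum>M\<in>mset_parts n. c (1 / z_mset M) *
      (\<Sum>k=1..n. of_nat (count M k) * (of_nat k * a k * (\<Prod>i\<in>#M - {#k#}. a i))))"
    by (intro sum.cong refl arg_cong[of _ _ "(*) _"] weight)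
  also have "\<dots> = (\<Sum>k=1..n. c (1 / of_nat k) * (of_nat k * a k) * cycle_index a (n - k))"
    by (rule sum_marked_parts)
  also have "\<dots> = (\<Sum>k=1..n. a k * cycle_index a (n - k))"
    by (intro sum.cong refl) (simp flip: mult.assoc add: c_inverse)
  finally show ?thesis .
qed

text \<open>Newton's recurrence determines the sequence because a positive integer is invertible in a
  \<open>\<rat>\<close>-algebra.\<close>
lemma cycle_index_unique:
  assumes "g 0 = 1" and "\<And>n. n \<ge> 1 \<Longrightarrow> of_nat n * g n = (\<Sum>k=1..n. a k * g (n - k))"
  shows "g n = cycle_index a n"
proof (induction n rule: less_induct)
  case (less n)
  show ?case
  proof (cases "n = 0")
    case False
    then have "of_nat n * g n = of_nat n * cycle_index a n"
      using assms(2)[of n] less by (simp add: cycle_index_recurrence)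
    then have "c (1 / of_nat n) * of_nat n * g n = c (1 / of_nat n) * of_nat n * cycle_index a n"
      by (simp only: mult.assoc)
    then show ?thesis
      using False by (simp add: c_inverse)
  qed (simp add: assms(1) cycle_index_0)
qed

text \<open>The formula \<open>D (exp A) = D A exp A\<close>, read off at the coefficient of \<open>t\<^sup>n\<close>. By the Leibniz rule
  \<open>D\<close> marks one part and differentiates its factor.\<close>
lemma cycle_index_derivation:
  assumes add: "\<And>x y. D (x + y) = D x + D y"
    and leibniz: "\<And>x y. D (x * y) = D x * y + x * D y"
    and const: "\<And>q. D (c q) = 0"
  shows "D (cycle_index a n) = (\<Sum>k=1..n. c (1 / of_nat k) * D (a k) * cycle_index a (n - k))"
proof -
  have "D 0 = 0"
    using add[of 0 0] by simp
  then have D_sum: "D (sum f A) = (\<Sum>x\<in>A. D (f x))" for f :: "'b \<Rightarrow> 'a" and A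
    by (induction A rule: infinite_finite_induct) (simp_all add: add)
  have D_prod: "D (\<Prod>i\<in>#M. a i) = (\<Sum>k\<in>#M. D (a k) * (\<Prod>i\<in>#M - {#k#}. a i))" for M
  proof (induction M)
    case (add x M)
    have "(\<Sum>k\<in>#M. D (a k) * (\<Prod>i\<in>#add_mset x M - {#k#}. a i)) =
        (\<Sum>k\<in>#M. a x * (D (a k) * (\<Prod>i\<in>#M - {#k#}. a i)))"
      by (intro arg_cong[of _ _ sum_mset] image_mset_cong) (auto simp: mult_ac dest!: multi_member_split)
    then show ?case
      by (simp add: leibniz add.IH sum_mset_distrib_left)
  qed (use const[of 1] in \<open>simp add: c_1\<close>)
  have "D (\<Prod>i\<in>#M. a i) = (\<Sum>k=1..n. of_nat (count M k) * (D (a k) * (\<Prod>i\<in>#M - {#k#}. a i)))"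
    if M: "M \<in> mset_parts n" for M
  proof -
    have "set_mset M \<subseteq> {1..n}"
      using le_of_mem_mset_parts[OF M] by auto
    then show ?thesis
      unfolding D_prod by (simp add: sum_mset_superset)
  qed
  then have "D (cycle_index a n) = (\<Sum>M\<in>mset_parts n. c (1 / z_mset M) *
      (\<Sum>k=1..n. of_nat (count M k) * (D (a k) * (\<Prod>i\<in>#M - {#k#}. a i))))"
    by (simp add: cycle_index_mset D_sum leibniz const cong: sum.cong)
  also have "\<dots> = (\<Sum>k=1..n. c (1 / of_nat k) * D (a k) * cycle_index a (n - k))"
    by (rule sum_marked_parts)
  finally show ?thesis .
qed

end

section \<open>Binomial identities\<close>

text \<open>Expanding the last binomial coefficient by Vandermonde's convolution and interchanging the sums
  makes the sum over \<open>j\<close> another Vandermonde sum. What remains contains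
  \<open>((x + r) choose (r + s - i)) * ((r + s - i) choose r) = ((x + r) choose r) * (x choose (s - i))\<close>,
  and the sum over \<open>i\<close> is a third Vandermonde sum.\<close>
lemma sum_choose_product:
  fixes x r s :: nat
  shows "(\<Sum>j\<le>r + s. (r choose j) * (s choose j) * ((x + r + s - j) choose (r + s))) =
    ((x + r) choose r) * ((x + s) choose s)"
proof -
  have expand: "(x + r + s - j) choose (r + s) = (\<Sum>i\<le>s. ((s - j) choose i) * ((x + r) choose (r + s - i)))"
    if "j \<le> s" for j
  proof -
    have "(x + r + s - j) choose (r + s) = ((s - j) + (x + r)) choose (r + s)"
      using that by (simp add: algebra_simps)
    also have "\<dots> = (\<Sum>i\<le>r + s. ((s - j) choose i) * ((x + r) choose (r + s - i)))"
      by (rule vandermonde[symmetric])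
    also have "\<dots> = (\<Sum>i\<le>s. ((s - j) choose i) * ((x + r) choose (r + s - i)))"
      by (rule sum.mono_neutral_right) (auto simp: binomial_eq_0)
    finally show ?thesis .
  qed
  have swap: "(s choose j) * ((s - j) choose i) = (s choose i) * ((s - i) choose j)"
    if "i \<le> s" "j \<le> s" for i j
  proof (cases "i + j \<le> s")
    case True
    then show ?thesis
      using choose_mult[of j "i + j" s] choose_mult[of i "i + j" s] binomial_symmetric[of i "i + j"]
      by simp
  qed (use that in \<open>simp add: binomial_eq_0\<close>)
  have "(\<Sum>j\<le>r + s. (r choose j) * (s choose j) * ((x + r + s - j) choose (r + s))) =
     (\<Sum>j\<le>s. (r choose j) * (s choose j) * ((x + r + s - j) choose (r + s)))"
    by (rule sum.mono_neutral_right) (auto simp: binomial_eq_0)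
  also have "\<dots> = (\<Sum>j\<le>s. \<Sum>i\<le>s. (r choose j) * ((s choose j) * ((s - j) choose i)) * ((x + r) choose (r + s - i)))"
    by (intro sum.cong refl) (simp add: expand sum_distrib_left mult_ac)
  also have "\<dots> = (\<Sum>j\<le>s. \<Sum>i\<le>s. (r choose j) * ((s choose i) * ((s - i) choose j)) * ((x + r) choose (r + s - i)))"
    by (intro sum.cong refl) (simp add: swap)
  also have "\<dots> = (\<Sum>i\<le>s. \<Sum>j\<le>s. (r choose j) * ((s choose i) * ((s - i) choose j)) * ((x + r) choose (r + s - i)))"
    by (rule sum.swap)
  also have "\<dots> = (\<Sum>i\<le>s. (s choose i) * ((x + r) choose (r + s - i)) * ((r + s - i) choose r))"
  proof (intro sum.cong refl)
    fix i assume i: "i \<in> {..s}"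
    have "(\<Sum>j\<le>s. (r choose j) * ((s - i) choose j)) = (\<Sum>j\<le>s - i. (r choose j) * ((s - i) choose j))"
      by (rule sum.mono_neutral_right) (auto simp: binomial_eq_0)
    also have "\<dots> = (\<Sum>j\<le>s - i. (r choose j) * ((s - i) choose (s - i - j)))"
      by (intro sum.cong refl) (metis atMost_iff binomial_symmetric)
    also have "\<dots> = (r + (s - i)) choose (s - i)"
      by (rule vandermonde)
    also have "\<dots> = (r + s - i) choose r"
      using i binomial_symmetric[of r "r + (s - i)"] by simp
    finally have inner: "(\<Sum>j\<le>s. (r choose j) * ((s - i) choose j)) = (r + s - i) choose r" .
    show "(\<Sum>j\<le>s. (r choose j) * ((s choose i) * ((s - i) choose j)) * ((x + r) choose (r + s - i))) =
      (s choose i) * ((x + r) choose (r + s - i)) * ((r + s - i) choose r)"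
      unfolding inner[symmetric] sum_distrib_left by (simp add: mult_ac)
  qed
  also have "\<dots> = (\<Sum>i\<le>s. ((x + r) choose r) * ((s choose i) * (x choose (s - i))))"
  proof (intro sum.cong refl)
    fix i assume i: "i \<in> {..s}"
    have "((x + r) choose (r + s - i)) * ((r + s - i) choose r) = ((x + r) choose r) * (x choose (s - i))"
      using i choose_mult[of r "r + s - i" "x + r"]
      by (cases "r + s - i \<le> x + r") (auto simp: binomial_eq_0)
    then show "(s choose i) * ((x + r) choose (r + s - i)) * ((r + s - i) choose r) =
       ((x + r) choose r) * ((s choose i) * (x choose (s - i)))"
      by (simp add: mult_ac)
  qed
  also have "\<dots> = ((x + r) choose r) * ((x + s) choose s)"
    by (simp add: vandermonde add.commute flip: sum_distrib_left)
  finally show ?thesis .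
qed

lemma nbinom_eq_0: "p \<le> n \<Longrightarrow> k > n \<Longrightarrow> nbinom n p k = 0"
  by (cases "n = 0") (auto simp: nbinom_def intro!: sum.neutral binomial_eq_0 split: nat_diff_split)

lemma nbinom_0_right: "nbinom n p 0 = 0"
  by (simp add: nbinom_def)

lemma pochhammer_of_nat_over_fact:
  assumes "K > 0"
  shows "pochhammer (of_nat K) r / fact r = (of_nat ((K + r - 1) choose r) :: rat)"
  using assms
  by (simp add: binomial_gbinomial gbinomial_pochhammer' of_nat_diff)

text \<open>The numerical core. Since \<open>nbinom n p j\<close> carries the factor \<open>n / j\<close>, the scaling removes it and
  leaves a double sum of integers. For fixed summation index \<open>i\<close> of \<open>nbinom\<close> the sum over \<open>j\<close> is a
  Vandermonde sum, and \<open>sum_choose_product\<close> with \<open>x = K - 1\<close> evaluates the rest.\<close>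
lemma sum_nbinom_choose:
  fixes K r s :: nat
  assumes "r + s \<ge> 1" "K \<ge> 1"
  shows "(\<Sum>j=1..r + s. of_nat j / of_nat (r + s) * nbinom (r + s) r j * of_nat (K choose j)) =
    pochhammer (of_nat K) r / fact r * (pochhammer (of_nat K) s / fact s)"
proof -
  define m where "m = r + s"
  have m: "m \<ge> 1" using assms by (simp add: m_def)
  have "(\<Sum>j=1..m. of_nat j / of_nat m * nbinom m r j * of_nat (K choose j)) =
     (of_nat (\<Sum>j=1..m. \<Sum>i<j. (r choose i) * (s choose i) * ((m - i - 1) choose (j - i - 1)) * (K choose j)) :: rat)"
    using m unfolding of_nat_sum
    by (intro sum.cong refl) (simp add: nbinom_def m_def sum_distrib_right sum_distrib_left mult_ac)
  also have "(\<Sum>j=1..m. \<Sum>i<j. (r choose i) * (s choose i) * ((m - i - 1) choose (j - i - 1)) * (K choose j)) =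
     (\<Sum>j=1..m. \<Sum>i<m. if i < j then (r choose i) * (s choose i) * ((m - i - 1) choose (j - i - 1)) * (K choose j) else 0)"
    by (intro sum.cong refl sum.mono_neutral_cong_left) auto
  also have "\<dots> = (\<Sum>i<m. \<Sum>j=1..m. if i < j then (r choose i) * (s choose i) * ((m - i - 1) choose (j - i - 1)) * (K choose j) else 0)"
    by (rule sum.swap)
  also have "\<dots> = (\<Sum>i<m. \<Sum>j=i+1..m. (r choose i) * (s choose i) * ((m - i - 1) choose (j - i - 1)) * (K choose j))"
    by (intro sum.cong refl sum.mono_neutral_cong_right) auto
  also have "\<dots> = (\<Sum>i<m. (r choose i) * (s choose i) * ((K - 1 + r + s - i) choose (r + s)))"
  proof (intro sum.cong refl)
    fix i assume i: "i \<in> {..<m}"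
    \<comment> \<open>Put \<open>l = m - j\<close> and use the symmetry of the first binomial coefficient.\<close>
    have "(\<Sum>j=i+1..m. ((m - i - 1) choose (j - i - 1)) * (K choose j)) =
       (\<Sum>l\<le>m - i - 1. ((m - i - 1) choose l) * (K choose (m - l)))"
      by (rule sum.reindex_bij_witness[of _ "\<lambda>l. m - l" "\<lambda>j. m - j"])
         (use i in \<open>auto simp: binomial_symmetric[of "_ - Suc i"]\<close>)
    also have "\<dots> = (\<Sum>l\<le>m. ((m - i - 1) choose l) * (K choose (m - l)))"
      by (rule sum.mono_neutral_left) (auto simp: binomial_eq_0)
    also have "\<dots> = (m - i - 1 + K) choose m"
      by (rule vandermonde)
    also have "m - i - 1 + K = K - 1 + r + s - i"
      using i assms by (simp add: m_def)
    finally show "(\<Sum>j=i+1..m. (r choose i) * (s choose i) * ((m - i - 1) choose (j - i - 1)) * (K choose j)) =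
        (r choose i) * (s choose i) * ((K - 1 + r + s - i) choose (r + s))"
      by (simp add: mult.assoc m_def flip: sum_distrib_left)
  qed
  also have "\<dots> = (\<Sum>i\<le>m. (r choose i) * (s choose i) * ((K - 1 + r + s - i) choose (r + s)))"
    using m by (intro sum.mono_neutral_left) (auto simp: not_less m_def binomial_eq_0)
  also have "\<dots> = ((K - 1 + r) choose r) * ((K - 1 + s) choose s)"
    unfolding m_def by (rule sum_choose_product)
  finally show ?thesis
    using assms by (simp add: pochhammer_of_nat_over_fact m_def)
qed

section \<open>The polynomials as a cycle index\<close>

lemma Con_add: "Con (x + y) = Con x + Con y"
  by (simp add: Con_def single_add)

lemma Con_mult: "Con (x * y) = Con x * Con y"
  by (simp add: Con_def mult_single)

lemma Con_0: "Con 0 = 0"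
  by (simp add: Con_def)

lemma Con_1: "Con 1 = 1"
  by (simp add: Con_def)

lemma Con_of_nat: "Con (of_nat n) = of_nat n"
  by (simp add: Con_def)

lemma Con_sum: "Con (sum f A) = (\<Sum>x\<in>A. Con (f x))"
  by (induction A rule: infinite_finite_induct) (simp_all add: Con_0 Con_add)

lemma Con_prod: "Con (prod f A) = (\<Prod>x\<in>A. Con (f x))"
  by (induction A rule: infinite_finite_induct) (simp_all add: Con_1 Con_mult)

lemma series2_nth [simp]: "series2 f $ p $ q = f p q"
  by (simp add: series2_def)

lemma fps2_eqI: "(\<And>p q. f $ p $ q = g $ p $ q) \<Longrightarrow> f = g"
  by (simp add: fps_eq_iff)

lemma const2_mult_nth: "(const2 c * f) $ p $ q = c * f $ p $ q"
  for c :: "'a :: comm_semiring_1"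
  by (simp add: const2_def)

lemma fps2_mult_nth:
  "(f * g) $ p $ q = (\<Sum>r\<le>p. \<Sum>s\<le>q. f $ r $ s * g $ (p - r) $ (q - s))"
  for f g :: "'a :: comm_semiring_1 fps fps"
  by (simp add: fps_mult_nth fps_sum_nth atLeast0AtMost)

lemma of_nat_fps2_mult_nth: "(of_nat n * f) $ p $ q = of_nat n * f $ p $ q"
  for f :: "'a :: comm_ring_1 fps fps"
  by (simp flip: fps_of_nat)

interpretation qpoly2: rat_algebra "\<lambda>c. const2 (Con c)"
  by standard (simp_all add: const2_def Con_1 Con_add Con_mult)

lemma fps2_prod_nth:
  fixes f :: "nat \<Rightarrow> 'a :: comm_ring_1 fps fps"
  shows "(\<Prod>i<l. f i) $ p $ k =
    (\<Sum>ps\<in>natpermute p l. \<Sum>ks\<in>natpermute k l. \<Prod>i<l. f i $ (ps ! i) $ (ks ! i))"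
proof (cases l)
  case 0
  have "natpermute n 0 = (if n = 0 then {[]} else {})" for n
    by (auto simp: natpermute_def)
  then show ?thesis
    using 0 by simp
next
  case (Suc m)
  have nth: "(\<Prod>i\<le>m. g i) $ n = (\<Sum>v\<in>natpermute n (Suc m). \<Prod>i\<le>m. g i $ (v ! i))"
    for g :: "nat \<Rightarrow> 'b :: comm_ring_1 fps" and n
    using fps_prod_nth[of g m n] by (simp add: atLeast0AtMost)
  show ?thesis
    by (simp add: Suc lessThan_Suc_atMost nth fps_sum_nth)
qed

text \<open>The contribution of one part \<open>m\<close> to a term of \<open>Ppoly\<close>. The outer variable records \<open>p\<close>, the inner
  one \<open>k\<close>. A decomposition of \<open>p\<close> allots at most \<open>m\<close> to the part \<open>m\<close>, hence the cut-off; it allots at least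
  \<open>1\<close> of \<open>k\<close>, which is reflected by \<open>nbinom m p 0 = 0\<close>.\<close>
definition part_series :: "nat \<Rightarrow> qpoly fps fps" where
  "part_series m = series2 (\<lambda>p k. if p \<le> m then Con (nbinom m p k) * Ind m else 0)"

text \<open>A coefficient of a product of series is a sum over all ways to split both exponents among the
  factors. Splittings outside \<open>subweights\<close> or \<open>compositions\<close> contribute zero.\<close>
lemma prod_part_series_nth:
  "(\<Prod>i<length \<mu>. part_series (\<mu> ! i)) $ p $ k = Con (pbinom \<mu> p k) * (\<Prod>i<length \<mu>. Ind (\<mu> ! i))"
proof -
  define l where "l = length \<mu>"
  define T where "T ps ks = (\<Prod>i<l. part_series (\<mu> ! i) $ (ps ! i) $ (ks ! i))" for ps ks
  have "(\<Prod>i<l. part_series (\<mu> ! i)) $ p $ k = (\<Sum>ps\<in>natpermute p l. \<Sum>ks\<in>natpermute k l. T ps ks)"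
    unfolding T_def by (rule fps2_prod_nth)
  also have "\<dots> = (\<Sum>ps\<in>subweights \<mu> p. \<Sum>ks\<in>natpermute k l. T ps ks)"
  proof (rule sum.mono_neutral_right)
    show "\<forall>ps\<in>natpermute p l - subweights \<mu> p. (\<Sum>ks\<in>natpermute k l. T ps ks) = 0"
      by (auto simp: T_def natpermute_def subweights_def l_def part_series_def
          intro!: sum.neutral prod_zero)
  qed (auto simp: natpermute_finite, auto simp: natpermute_def subweights_def l_def)
  also have "\<dots> = (\<Sum>ps\<in>subweights \<mu> p. \<Sum>ks\<in>compositions l k. T ps ks)"
  proof (rule sum.cong[OF refl])
    fix ps
    have "T ps ks = 0" if "ks \<in> natpermute k l - compositions l k" for ks
    proof -
      have "\<exists>i<l. ks ! i = 0"
        using that by (simp add: natpermute_def compositions_def not_less_eq_eq)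
      then obtain i where "i < l" "ks ! i = 0"
        by blast
      then show ?thesis
        by (auto simp: T_def part_series_def nbinom_0_right Con_0 intro!: prod_zero bexI[of _ i])
    qed
    then show "(\<Sum>ks\<in>natpermute k l. T ps ks) = (\<Sum>ks\<in>compositions l k. T ps ks)"
      by (intro sum.mono_neutral_right)
         (auto simp: natpermute_finite, auto simp: natpermute_def compositions_def)
  qed
  also have "\<dots> = (\<Sum>ps\<in>subweights \<mu> p. \<Sum>ks\<in>compositions l k.
      Con (\<Prod>i<l. nbinom (\<mu> ! i) (ps ! i) (ks ! i)) * (\<Prod>i<l. Ind (\<mu> ! i)))"
    by (intro sum.cong refl)
       (auto simp: T_def part_series_def Con_prod subweights_def l_def simp flip: prod.distrib intro!: prod.cong)
  also have "\<dots> = Con (pbinom \<mu> p k) * (\<Prod>i<l. Ind (\<mu> ! i))"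
    by (simp add: pbinom_def Con_sum sum_distrib_right l_def)
  finally show ?thesis
    by (simp add: l_def)
qed

lemma prod_count_partition:
  fixes f :: "nat \<Rightarrow> 'a :: comm_monoid_mult"
  assumes "\<mu> \<in> partitions_of n"
  shows "(\<Prod>i=1..n. f i ^ count_list \<mu> i) = (\<Prod>i<length \<mu>. f (\<mu> ! i))"
proof -
  have "(\<Prod>i=1..n. f i ^ count_list \<mu> i) = (\<Prod>i\<in>#mset \<mu>. f i)"
    by (subst prod_mset_superset[of "{1..n}"])
       (use assms in \<open>auto simp: partitions_of_def count_mset intro: member_le_sum_list\<close>)
  also have "\<dots> = prod_list (map f \<mu>)"
    by (metis mset_map prod_mset_prod_list)
  finally show ?thesis
    by (simp add: prod.list_conv_set_nth atLeast0LessThan)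
qed

text \<open>The exceptional values at \<open>k = 0\<close> are those that the general formula produces: \<open>0\<close> has no
  composition into one or more positive parts, and the empty partition has exactly the empty composition.\<close>
lemma Ppoly_eq_sum:
  "Ppoly n p k = (\<Sum>\<mu>\<in>partitions_of n. Con (1 / z_part \<mu> * pbinom \<mu> p k) *
     (\<Prod>i=1..n. Ind i ^ count_list \<mu> i))"
proof (cases "k = 0")
  case True
  show ?thesis
  proof (cases "n = 0")
    case n: True
    have "\<mu> = []" if "\<mu> \<in> partitions_of 0" for \<mu>
      using that by (cases \<mu>) (simp_all add: partitions_of_def)
    moreover have "[] \<in> partitions_of 0"
      by (simp add: partitions_of_def)
    ultimately have "partitions_of 0 = {[]}"
      by blast
    moreover have "subweights [] p = (if p = 0 then {[]} else {})" "compositions 0 0 = {[]}"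
      by (auto simp: subweights_def compositions_def)
    ultimately show ?thesis
      using n True by (simp add: Ppoly_def z_part_def pbinom_def Con_0 Con_1)
  next
    case n: False
    have "compositions (length \<mu>) 0 = {}" if "\<mu> \<in> partitions_of n" for \<mu>
    proof -
      have "0 < length \<mu>"
        using that n by (auto simp: partitions_of_def)
      then have False if "ks \<in> compositions (length \<mu>) 0" for ks
        using that elem_le_sum_list[of 0 ks] by (auto simp: compositions_def simp del: sum_list_eq_0_iff)
      then show ?thesis
        by blast
    qed
    then show ?thesis
      using n True by (simp add: Ppoly_def pbinom_def Con_0)
  qed
qed (simp add: Ppoly_def)

text \<open>The polynomials with weight \<open>n\<close>, collected in one series over \<open>p\<close> and \<open>k\<close>, form a cycle index
  because \<open>pbinom\<close> is multiplicative over the parts.\<close>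
lemma cycle_index_part_series: "qpoly2.cycle_index part_series n = series2 (Ppoly n)"
proof (rule fps2_eqI)
  fix p k
  have "qpoly2.cycle_index part_series n $ p $ k =
      (\<Sum>\<mu>\<in>partitions_of n. Con (1 / z_part \<mu>) * (Con (pbinom \<mu> p k) * (\<Prod>i<length \<mu>. Ind (\<mu> ! i))))"
    unfolding qpoly2.cycle_index_def fps_sum_nth
    by (intro sum.cong refl) (simp add: const2_mult_nth prod_count_partition prod_part_series_nth del: One_nat_def)
  also have "\<dots> = Ppoly n p k"
    unfolding Ppoly_eq_sum
    by (intro sum.cong refl) (simp only: prod_count_partition Con_mult mult.assoc)
  finally show "qpoly2.cycle_index part_series n $ p $ k = series2 (Ppoly n) $ p $ k"
    by simp
qed

lemma Ppoly_eq_0: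
  assumes "n < p \<or> n < k"
  shows "Ppoly n p k = 0"
proof -
  have "pbinom \<mu> p k = 0" if "\<mu> \<in> partitions_of n" for \<mu>
  proof -
    have n: "n = (\<Sum>i<length \<mu>. \<mu> ! i)"
      using that by (simp add: partitions_of_def sum_list_sum_nth atLeast0LessThan)
    from assms show ?thesis
    proof
      assume "n < p"
      have "sum_list ps \<le> n" if "ps \<in> subweights \<mu> p" for ps
        using that unfolding n
        by (auto simp: subweights_def sum_list_sum_nth atLeast0LessThan intro!: sum_mono)
      then have "subweights \<mu> p = {}"
        using \<open>n < p\<close> by (fastforce simp: subweights_def)
      then show ?thesis
        by (simp add: pbinom_def)
    next
      assume "n < k"
      have "\<exists>i<length \<mu>. \<mu> ! i < ks ! i" if "ks \<in> compositions (length \<mu>) k" for ks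
      proof (rule ccontr)
        assume "\<not> ?thesis"
        then have "ks ! i \<le> \<mu> ! i" if "i < length \<mu>" for i
          using that by (meson not_less)
        then have "sum_list ks \<le> n"
          using that unfolding n
          by (auto simp: compositions_def sum_list_sum_nth atLeast0LessThan intro!: sum_mono)
        then show False
          using that \<open>n < k\<close> by (simp add: compositions_def)
      qed
      then show ?thesis
        by (fastforce simp: pbinom_def subweights_def intro!: sum.neutral prod_zero nbinom_eq_0)
    qed
  qed
  then show ?thesis
    by (simp add: Ppoly_eq_sum Con_0)
qed

text \<open>The Euler operator \<open>y d/dy\<close> in the variable \<open>y\<close> that records \<open>k\<close>.\<close>
definition inner_euler :: "'a :: comm_ring_1 fps fps \<Rightarrow> 'a fps fps" where
  "inner_euler f = Abs_fps (\<lambda>p. fps_X * fps_deriv (f $ p))"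

lemma X_deriv_nth: "(fps_X * fps_deriv f) $ n = of_nat n * f $ n"
  for f :: "'a :: comm_ring_1 fps"
  by (cases n) simp_all

lemma inner_euler_nth: "inner_euler f $ p $ k = of_nat k * f $ p $ k"
  by (simp add: inner_euler_def X_deriv_nth)

text \<open>The coefficient of \<open>y\<^sup>j\<close> in \<open>y d/dy (\<Sum>\<^sub>k nbinom m r k y\<^sup>k / m)\<close> for \<open>m = r + s\<close>. For
  \<open>r = s = 0\<close> it is \<open>0\<close> by the convention \<open>x / 0 = 0\<close>, so that sums over \<open>r\<close> and \<open>s\<close> may include
  this index although there is no part \<open>0\<close>.\<close>
definition scaled_nbinom :: "nat \<Rightarrow> nat \<Rightarrow> nat \<Rightarrow> rat" where
  "scaled_nbinom r s j = of_nat j / of_nat (r + s) * nbinom (r + s) r j"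

text \<open>Compare coefficients in \<open>cycle_index_derivation\<close> for the Euler operator.\<close>
lemma Ppoly_euler:
  "of_nat k * Ppoly n p k = (\<Sum>m=1..n. \<Sum>r\<le>p. \<Sum>j\<le>k.
     (if r \<le> m then Con (of_nat j / of_nat m * nbinom m r j) * Ind m * Ppoly (n - m) (p - r) (k - j) else 0))"
proof -
  have "inner_euler (qpoly2.cycle_index part_series n) =
      (\<Sum>m=1..n. const2 (Con (1 / of_nat m)) * inner_euler (part_series m) * qpoly2.cycle_index part_series (n - m))"
  proof (rule qpoly2.cycle_index_derivation)
    show "inner_euler (x + y) = inner_euler x + inner_euler y" for x y :: "qpoly fps fps"
      by (rule fps2_eqI) (simp add: inner_euler_nth algebra_simps)
    show "inner_euler (x * y) = inner_euler x * y + x * inner_euler y" for x y :: "qpoly fps fps"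
      by (rule fps_ext)
         (simp add: inner_euler_def fps_mult_nth fps_deriv_sum sum_distrib_left flip: sum.distrib,
          simp add: algebra_simps)
    show "inner_euler (const2 (Con c)) = 0" for c
      by (rule fps2_eqI) (simp add: inner_euler_nth const2_def)
  qed
  then have "inner_euler (series2 (Ppoly n)) $ p $ k =
      (\<Sum>m=1..n. const2 (Con (1 / of_nat m)) * (inner_euler (part_series m) * series2 (Ppoly (n - m)))) $ p $ k"
    unfolding cycle_index_part_series by (simp add: mult.assoc)
  then have "of_nat k * Ppoly n p k = (\<Sum>m=1..n. Con (1 / of_nat m) *
      (\<Sum>r\<le>p. \<Sum>j\<le>k. of_nat j * part_series m $ r $ j * Ppoly (n - m) (p - r) (k - j)))"
    by (simp only: inner_euler_nth fps_sum_nth const2_mult_nth) (simp add: fps2_mult_nth inner_euler_nth)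
  also have "\<dots> = (\<Sum>m=1..n. \<Sum>r\<le>p. \<Sum>j\<le>k.
     (if r \<le> m then Con (of_nat j / of_nat m * nbinom m r j) * Ind m * Ppoly (n - m) (p - r) (k - j) else 0))"
    unfolding sum_distrib_left
  proof (intro sum.cong refl)
    fix m r j
    have "Con (of_nat j / of_nat m * nbinom m r j) = Con (1 / of_nat m) * (of_nat j * Con (nbinom m r j))"
      by (simp flip: Con_mult Con_of_nat)
    then show "Con (1 / of_nat m) * (of_nat j * part_series m $ r $ j * Ppoly (n - m) (p - r) (k - j)) =
       (if r \<le> m then Con (of_nat j / of_nat m * nbinom m r j) * Ind m * Ppoly (n - m) (p - r) (k - j) else 0)"
      by (simp add: part_series_def mult_ac)
  qed
  finally show ?thesis .
qed

text \<open>The same recurrence in the exponents \<open>p\<close> of \<open>u\<close> and \<open>q\<close> of \<open>v\<close>: the removed part is \<open>m = r + s\<close>.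
  Parts with \<open>s > q\<close> drop out, since they would leave weight less than \<open>p - r\<close>.\<close>
lemma Ppoly_recurrence:
  "of_nat k * Ppoly (p + q) p k = (\<Sum>r\<le>p. \<Sum>s\<le>q. \<Sum>j\<le>k.
     Con (scaled_nbinom r s j) * Ind (r + s) * Ppoly (p - r + (q - s)) (p - r) (k - j))"
proof -
  define T where "T r m = (\<Sum>j\<le>k. Con (of_nat j / of_nat m * nbinom m r j) * Ind m *
    Ppoly (p + q - m) (p - r) (k - j))" for r m
  have "of_nat k * Ppoly (p + q) p k = (\<Sum>m=1..p+q. \<Sum>r\<le>p. if r \<le> m then T r m else 0)"
    unfolding Ppoly_euler T_def by (intro sum.cong refl) auto
  also have "\<dots> = (\<Sum>r\<le>p. \<Sum>m=1..p+q. if r \<le> m then T r m else 0)"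
    by (rule sum.swap)
  also have "\<dots> = (\<Sum>r\<le>p. \<Sum>m=r..r+q. T r m)"
  proof (rule sum.cong[OF refl])
    fix r assume r: "r \<in> {..p}"
    have "T r 0 = 0"
      by (simp add: T_def Con_0)
    moreover have "T r m = 0" if "m > r + q" "m \<le> p + q" for m
    proof -
      have "p + q - m < p - r"
        using r that by auto
      then show ?thesis
        by (simp add: T_def Ppoly_eq_0)
    qed
    ultimately show "(\<Sum>m=1..p+q. if r \<le> m then T r m else 0) = (\<Sum>m=r..r+q. T r m)"
      using r by (intro sum.mono_neutral_cong) (auto simp: not_less_eq_eq)
  qed
  also have "\<dots> = (\<Sum>r\<le>p. \<Sum>s\<le>q. T r (r + s))"
  proof (rule sum.cong[OF refl])
    fix r
    show "(\<Sum>m=r..r+q. T r m) = (\<Sum>s\<le>q. T r (r + s))"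
      by (rule sum.reindex_bij_witness[of _ "\<lambda>s. r + s" "\<lambda>m. m - r"]) auto
  qed
  also have "\<dots> = (\<Sum>r\<le>p. \<Sum>s\<le>q. \<Sum>j\<le>k.
     Con (scaled_nbinom r s j) * Ind (r + s) * Ppoly (p - r + (q - s)) (p - r) (k - j))"
    unfolding T_def scaled_nbinom_def by (intro sum.cong refl) auto
  finally show ?thesis .
qed

section \<open>Power series in the weight variable\<close>

lemma Con_inverse_fact: "Con (1 / fact (Suc m)) * of_nat (Suc m) = Con (1 / fact m)"
proof -
  have "Con (1 / fact (Suc m)) * of_nat (Suc m) = Con (1 / fact (Suc m) * of_nat (Suc m))"
    by (simp only: Con_mult Con_of_nat)
  also have "1 / fact (Suc m) * of_nat (Suc m) = (1 / fact m :: rat)"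
    by (simp add: divide_simps del: of_nat_Suc)
  finally show ?thesis .
qed

lemma poly_choose_0: "poly_choose a 0 = 1"
  by (simp add: poly_choose_def Con_1)

lemma poly_choose_Suc_factor_last:
  "of_nat (Suc m) * poly_choose a (Suc m) = (a - of_nat m) * poly_choose a m"
  unfolding poly_choose_def Con_inverse_fact[of m, symmetric] prod.lessThan_Suc
  by (simp only: mult_ac)

lemma poly_choose_Suc_factor_first:
  "of_nat (Suc m) * poly_choose a (Suc m) = a * poly_choose (a - 1) m"
proof -
  have "(\<Prod>i<m. a - of_nat (Suc i)) = (\<Prod>i<m. a - 1 - of_nat i)"
    by (intro prod.cong refl) simp
  then have "(\<Prod>i<Suc m. a - of_nat i) = a * (\<Prod>i<m. a - 1 - of_nat i)"
    by (simp only: prod.lessThan_Suc_shift of_nat_0 diff_zero)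
  then show ?thesis
    unfolding poly_choose_def Con_inverse_fact[of m, symmetric] by (simp only: mult_ac)
qed

lemma qpoly_of_nat_cancel:
  fixes a b :: qpoly
  assumes "of_nat (Suc m) * a = of_nat (Suc m) * b"
  shows "a = b"
proof -
  have "Con (1 / of_nat (Suc m)) * of_nat (Suc m) = Con (1 / of_nat (Suc m) * of_nat (Suc m))"
    by (simp only: Con_mult Con_of_nat)
  also have "\<dots> = 1"
    by (simp add: Con_1 del: of_nat_Suc)
  finally have inv: "Con (1 / of_nat (Suc m)) * of_nat (Suc m) = 1" .
  have "Con (1 / of_nat (Suc m)) * of_nat (Suc m) * a = Con (1 / of_nat (Suc m)) * of_nat (Suc m) * b"
    using assms by (simp only: mult.assoc)
  then show ?thesis
    by (simp only: inv mult_1)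
qed

lemma poly_choose_pascal:
  "poly_choose (a + 1) (Suc m) = poly_choose a m + poly_choose a (Suc m)"
proof (rule qpoly_of_nat_cancel)
  have "of_nat (Suc m) * poly_choose (a + 1) (Suc m) = (a + 1) * poly_choose a m"
    by (simp only: poly_choose_Suc_factor_first add_diff_cancel_right')
  also have "\<dots> = of_nat (Suc m) * poly_choose a m + (a - of_nat m) * poly_choose a m"
    by (simp add: algebra_simps)
  also have "\<dots> = of_nat (Suc m) * (poly_choose a m + poly_choose a (Suc m))"
    by (simp only: poly_choose_Suc_factor_last distrib_left)
  finally show "of_nat (Suc m) * poly_choose (a + 1) (Suc m) =
      of_nat (Suc m) * (poly_choose a m + poly_choose a (Suc m))" .
qed

text \<open>The series \<open>1 / (1 - t)\<close>.\<close>
definition geom :: "'a :: comm_ring_1 fps" where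
  "geom = Abs_fps (\<lambda>_. 1)"

lemma one_minus_X_mult_nth: "((1 - fps_X) * f) $ n = f $ n - (if n = 0 then 0 else f $ (n - 1))"
  for f :: "'a :: comm_ring_1 fps"
  by (simp add: algebra_simps)

text \<open>The series have coefficients in a ring only, so identities with the denominator \<open>1 - t\<close> are proved by
  clearing it.\<close>
lemma eq_geom_multI:
  fixes f g :: "'a :: comm_ring_1 fps"
  assumes "(1 - fps_X) * f = g"
  shows "f = geom * g"
proof -
  have "(1 - fps_X) * geom = (1 :: 'a fps)"
    by (rule fps_ext) (simp add: one_minus_X_mult_nth geom_def)
  then show ?thesis
    unfolding assms[symmetric] mult.assoc[symmetric] by (simp add: mult.commute)
qed

text \<open>The series \<open>t\<^sup>k (1 - t) powr (-x - k)\<close>.\<close>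
definition choose_series :: "qpoly \<Rightarrow> nat \<Rightarrow> qpoly fps" where
  "choose_series x k = Abs_fps (\<lambda>n. if k \<le> n then poly_choose (x + of_nat n - 1) (n - k) else 0)"

text \<open>Multiplication by \<open>t / (1 - t)\<close>; after clearing the denominator this is Pascal's rule.\<close>
lemma choose_series_Suc: "choose_series x (Suc k) = geom * fps_X * choose_series x k"
  unfolding mult.assoc
proof (rule eq_geom_multI, rule fps_ext)
  fix n
  show "((1 - fps_X) * choose_series x (Suc k)) $ n = (fps_X * choose_series x k) $ n"
  proof (cases n)
    case (Suc m)
    consider "m < k" | "m = k" | j where "m = Suc (k + j)"
      by (metis less_imp_Suc_add linorder_neqE_nat)
    then show ?thesis
    proof cases
      case 3
      have "poly_choose (x + of_nat m) (Suc j) =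
          poly_choose (x + of_nat m - 1) j + poly_choose (x + of_nat m - 1) (Suc j)"
        using poly_choose_pascal[of "x + of_nat m - 1" j] by simp
      with 3 Suc show ?thesis
        by (simp add: one_minus_X_mult_nth choose_series_def Suc_diff_le add_ac)
    qed (use Suc in \<open>simp_all add: one_minus_X_mult_nth choose_series_def poly_choose_0\<close>)
  qed (simp add: one_minus_X_mult_nth choose_series_def)
qed

lemma choose_series_add: "choose_series x (k + j) = (geom * fps_X) ^ j * choose_series x k"
  by (induction j) (simp_all add: choose_series_Suc mult_ac)

text \<open>The logarithmic derivative \<open>t d/dt\<close> of \<open>t\<^sup>k (1 - t) powr (-x - k)\<close> is
  \<open>k + (x + k) t / (1 - t) = (k + x t) / (1 - t)\<close>. On coefficients it is the absorption identity for
  binomial coefficients.\<close>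
lemma choose_series_euler:
  "fps_X * fps_deriv (choose_series x k) = geom * ((of_nat k + fps_const x * fps_X) * choose_series x k)"
proof (rule eq_geom_multI, rule fps_ext)
  fix n
  show "((1 - fps_X) * (fps_X * fps_deriv (choose_series x k))) $ n =
      ((of_nat k + fps_const x * fps_X) * choose_series x k) $ n"
  proof -
    have lhs: "((1 - fps_X) * (fps_X * fps_deriv (choose_series x k))) $ n =
      of_nat n * choose_series x k $ n - (if n = 0 then 0 else of_nat (n - 1) * choose_series x k $ (n - 1))"
      by (simp only: one_minus_X_mult_nth X_deriv_nth)
    have rhs: "((of_nat k + fps_const x * fps_X) * choose_series x k) $ n =
      of_nat k * choose_series x k $ n + (if n = 0 then 0 else x * choose_series x k $ (n - 1))"
      by (simp add: distrib_right mult.assoc flip: fps_of_nat)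
    consider "n < k" | "n = k" | j where "n = Suc (k + j)"
      by (metis less_imp_Suc_add linorder_neqE_nat)
    then show ?thesis
    proof cases
      case 3
      have "of_nat (Suc j) * poly_choose (x + of_nat n - 1) (Suc j) =
          (x + of_nat n - 1) * poly_choose (x + of_nat n - 1 - 1) j"
        by (rule poly_choose_Suc_factor_first)
      then show ?thesis
        unfolding lhs rhs using 3 by (simp add: choose_series_def Suc_diff_le algebra_simps)
    qed (unfold lhs rhs, auto simp: choose_series_def)
  qed
qed

text \<open>The series \<open>t\<^sup>j / (1 - t)\<^bsup>j+1\<^esup>\<close>.\<close>
definition binomial_series :: "nat \<Rightarrow> qpoly fps" where
  "binomial_series j = Abs_fps (\<lambda>n. of_nat (n choose j))"

lemma binomial_series_eq: "binomial_series j = geom * (geom * fps_X) ^ j"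
proof (induction j)
  case 0
  show ?case
    by (simp add: binomial_series_def geom_def)
next
  case (Suc j)
  have "binomial_series (Suc j) = geom * (fps_X * binomial_series j)"
  proof (rule eq_geom_multI, rule fps_ext)
    fix n
    show "((1 - fps_X) * binomial_series (Suc j)) $ n = (fps_X * binomial_series j) $ n"
      by (cases n) (simp_all add: one_minus_X_mult_nth binomial_series_def)
  qed
  then show ?case
    by (simp add: Suc mult_ac)
qed

lemma binomial_series_mult_choose_series:
  "binomial_series j * choose_series x k = geom * choose_series x (k + j)"
  by (simp add: binomial_series_eq choose_series_add mult_ac)

text \<open>The coefficient of \<open>u\<^sup>r v\<^sup>s X\<^bsub>r+s\<^esub>\<close> in \<open>\<Sum>\<^sub>K S\<^sub>K t\<^sup>K\<close>, where \<open>S\<^sub>K\<close> is the double series in the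
  theorem. The sum starts at \<open>K = 1\<close>; this has to be enforced only for \<open>r = s = 0\<close>, as
  \<open>pochhammer 0 r = 0\<close> for \<open>r > 0\<close>.\<close>
definition pochhammer_series :: "nat \<Rightarrow> nat \<Rightarrow> qpoly fps" where
  "pochhammer_series r s = Abs_fps (\<lambda>K. if K = 0 then 0
     else Con (pochhammer (of_nat K) r / fact r * (pochhammer (of_nat K) s / fact s)))"

lemma scaled_nbinom_00: "scaled_nbinom 0 0 j = 0"
  by (simp add: scaled_nbinom_def)

lemma scaled_nbinom_eq_0: "r + s < j \<Longrightarrow> scaled_nbinom r s j = 0"
  by (simp add: scaled_nbinom_def nbinom_eq_0)

text \<open>For \<open>(r, s) \<noteq> (0, 0)\<close> the coefficient of \<open>t\<^sup>K\<close> is \<open>sum_nbinom_choose\<close>. The remaining case is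
  the geometric series \<open>t / (1 - t)\<close>, the logarithmic derivative \<open>t d/dt\<close> of \<open>(1 - t) powr (-1)\<close>.\<close>
lemma pochhammer_series_eq:
  "pochhammer_series r s = (\<Sum>j\<le>r + s. fps_const (Con (scaled_nbinom r s j)) * binomial_series j) +
     (if r = 0 \<and> s = 0 then geom * fps_X else 0)"
proof (cases "r = 0 \<and> s = 0")
  case True
  have "pochhammer_series 0 0 = geom * fps_X"
    by (rule fps_ext) (simp add: pochhammer_series_def geom_def Con_1)
  then show ?thesis
    using True by (simp add: scaled_nbinom_00 Con_0)
next
  case False
  have "pochhammer_series r s $ K = (\<Sum>j\<le>r + s. fps_const (Con (scaled_nbinom r s j)) * binomial_series j) $ K" for K
  proof -
    have "(\<Sum>j\<le>r + s. fps_const (Con (scaled_nbinom r s j)) * binomial_series j) $ K =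
        (\<Sum>j\<le>r + s. Con (scaled_nbinom r s j * of_nat (K choose j)))"
      by (simp add: fps_sum_nth binomial_series_def Con_mult Con_of_nat)
    also have "\<dots> = (\<Sum>j=1..r + s. Con (scaled_nbinom r s j * of_nat (K choose j)))"
      by (rule sum.mono_neutral_right) (auto simp: scaled_nbinom_def Con_0 not_less_eq_eq)
    also have "\<dots> = Con (\<Sum>j=1..r + s. scaled_nbinom r s j * of_nat (K choose j))"
      by (rule Con_sum[symmetric])
    also have "(\<Sum>j=1..r + s. scaled_nbinom r s j * of_nat (K choose j)) =
        (if K = 0 then 0 else pochhammer (of_nat K) r / fact r * (pochhammer (of_nat K) s / fact s))"
    proof (cases "K = 0")
      case True
      then show ?thesis
        by (auto intro!: sum.neutral)
    next
      case K: False
      have "r + s \<ge> 1" "K \<ge> 1"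
        using False K by linarith+
      from sum_nbinom_choose[OF this] show ?thesis
        using K by (simp only: scaled_nbinom_def if_False)
    qed
    also have "Con \<dots> = pochhammer_series r s $ K"
      by (simp add: pochhammer_series_def Con_0)
    finally show ?thesis ..
  qed
  then show ?thesis
    using False by (auto simp: fps_eq_iff)
qed

section \<open>The right-hand side as a cycle index\<close>

text \<open>The generating function over \<open>n\<close> of the coefficient of \<open>u\<^sup>p v\<^sup>q\<close> on the right-hand side of the
  theorem.\<close>
definition coeff_series :: "nat \<Rightarrow> nat \<Rightarrow> qpoly fps" where
  "coeff_series p q = (\<Sum>k\<le>p + q. fps_const (Ppoly (p + q) p k) * choose_series (Ind 0) k)"

lemma coeff_series_nth:
  "coeff_series p q $ n = (\<Sum>k = 0..min n (p + q). poly_choose (Ind 0 + of_nat n - 1) (n - k) * Ppoly (p + q) p k)"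
proof -
  have "coeff_series p q $ n = (\<Sum>k\<le>p + q. Ppoly (p + q) p k * choose_series (Ind 0) k $ n)"
    by (simp add: coeff_series_def fps_sum_nth)
  also have "\<dots> = (\<Sum>k = 0..min n (p + q). poly_choose (Ind 0 + of_nat n - 1) (n - k) * Ppoly (p + q) p k)"
    by (rule sum.mono_neutral_cong_right) (auto simp: choose_series_def mult.commute)
  finally show ?thesis .
qed

text \<open>The product of the series indexed by \<open>j\<close> and \<open>k\<close> depends only on \<open>j + k\<close>, by
  \<open>binomial_series_mult_choose_series\<close>. Collecting equal \<open>j + k\<close> brings the sum into the shape of
  \<open>Ppoly_recurrence\<close>; the pairs added to complete the triangle \<open>j + k \<le> p + q\<close> contribute zero.\<close>
lemma scaled_nbinom_convolution:
  assumes "r \<le> p" "s \<le> q"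
  shows "(\<Sum>j\<le>r + s. fps_const (Con (scaled_nbinom r s j)) * binomial_series j) * coeff_series (p - r) (q - s) =
    geom * (\<Sum>k\<le>p + q. \<Sum>j\<le>k.
      fps_const (Con (scaled_nbinom r s j) * Ppoly (p - r + (q - s)) (p - r) (k - j)) * choose_series (Ind 0) k)"
proof -
  define N where "N = p - r + (q - s)"
  define T where "T j k = fps_const (Con (scaled_nbinom r s j) * Ppoly N (p - r) k) * choose_series (Ind 0) (k + j)" for j k
  have N: "p + q = r + s + N"
    using assms by (simp add: N_def)
  have "(\<Sum>j\<le>r + s. fps_const (Con (scaled_nbinom r s j)) * binomial_series j) * coeff_series (p - r) (q - s) =
      (\<Sum>j\<le>r + s. \<Sum>k\<le>N. fps_const (Con (scaled_nbinom r s j)) * binomial_series j *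
         (fps_const (Ppoly N (p - r) k) * choose_series (Ind 0) k))"
    by (simp only: coeff_series_def sum_product N_def)
  also have "\<dots> = (\<Sum>j\<le>r + s. \<Sum>k\<le>N. geom * T j k)"
  proof (intro sum.cong[OF refl])
    fix j k
    have "fps_const (Con (scaled_nbinom r s j)) * binomial_series j *
         (fps_const (Ppoly N (p - r) k) * choose_series (Ind 0) k) =
      fps_const (Con (scaled_nbinom r s j)) * fps_const (Ppoly N (p - r) k) *
         (binomial_series j * choose_series (Ind 0) k)"
      by (simp only: mult_ac)
    also have "\<dots> = geom * T j k"
      unfolding binomial_series_mult_choose_series T_def fps_const_mult[symmetric] by (simp only: mult_ac)
    finally show "fps_const (Con (scaled_nbinom r s j)) * binomial_series j *
         (fps_const (Ppoly N (p - r) k) * choose_series (Ind 0) k) = geom * T j k" .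
  qed
  also have "\<dots> = geom * (\<Sum>j\<le>r + s. \<Sum>k\<le>N. T j k)"
    by (simp only: sum_distrib_left)
  also have "(\<Sum>j\<le>r + s. \<Sum>k\<le>N. T j k) = (\<Sum>(j, k)\<in>{..r + s} \<times> {..N}. T j k)"
    by (rule sum.cartesian_product)
  also have "(\<Sum>(j, k)\<in>{..r + s} \<times> {..N}. T j k) = (\<Sum>(j, k)\<in>{(j, k). j + k \<le> p + q}. T j k)"
  proof (rule sum.mono_neutral_left)
    show "finite {(j, k). j + k \<le> p + q}"
      by (rule finite_subset[of _ "{..p + q} \<times> {..p + q}"]) auto
    have "T j k = 0" if "r + s < j \<or> N < k" for j k
      using that by (auto simp: T_def scaled_nbinom_eq_0 Ppoly_eq_0 Con_0)
    then show "\<forall>i\<in>{(j, k). j + k \<le> p + q} - {..r + s} \<times> {..N}. (case i of (j, k) \<Rightarrow> T j k) = 0"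
      by clarsimp (metis not_le)
  qed (auto simp: N)
  also have "\<dots> = (\<Sum>k\<le>p + q. \<Sum>j\<le>k. T j (k - j))"
    by (rule sum.triangle_reindex_eq)
  also have "\<dots> = (\<Sum>k\<le>p + q. \<Sum>j\<le>k.
      fps_const (Con (scaled_nbinom r s j) * Ppoly N (p - r) (k - j)) * choose_series (Ind 0) k)"
    by (intro sum.cong refl) (simp add: T_def)
  finally show ?thesis
    by (simp only: N_def)
qed

lemma fps_const_sum: "fps_const (sum f A) = (\<Sum>x\<in>A. fps_const (f x))"
  by (rule fps_ext) (simp add: fps_sum_nth)

text \<open>By \<open>choose_series_euler\<close> the derivative splits into a part with the factor \<open>k\<close> and a part with
  the factor \<open>X\<^sub>0 t\<close>. In the first part \<open>Ppoly_recurrence\<close> and \<open>scaled_nbinom_convolution\<close> produce the terms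
  with \<open>(r, s) \<noteq> (0, 0)\<close>; the second part is the term \<open>r = s = 0\<close>.\<close>
lemma coeff_series_euler:
  "fps_X * fps_deriv (coeff_series p q) =
     (\<Sum>r\<le>p. \<Sum>s\<le>q. fps_const (Ind (r + s)) * pochhammer_series r s * coeff_series (p - r) (q - s))"
proof -
  define L where "L r s = (\<Sum>j\<le>r + s. fps_const (Con (scaled_nbinom r s j)) * binomial_series j)" for r s
  define Z where "Z = choose_series (Ind 0)"
  have "fps_X * fps_deriv (coeff_series p q) =
      (\<Sum>k\<le>p + q. fps_const (Ppoly (p + q) p k) * (fps_X * fps_deriv (Z k)))"
    by (simp add: coeff_series_def Z_def fps_deriv_sum sum_distrib_left mult.left_commute)
  also have "\<dots> = (\<Sum>k\<le>p + q. geom * (fps_const (of_nat k * Ppoly (p + q) p k) * Z k) +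
      fps_const (Ind 0) * (geom * fps_X) * (fps_const (Ppoly (p + q) p k) * Z k))"
    by (intro sum.cong refl)
       (simp only: Z_def choose_series_euler fps_const_mult[symmetric] fps_of_nat distrib_right distrib_left mult_ac)
  also have "\<dots> = geom * (\<Sum>k\<le>p + q. fps_const (of_nat k * Ppoly (p + q) p k) * Z k) +
      fps_const (Ind 0) * (geom * fps_X) * coeff_series p q"
    by (simp only: sum.distrib sum_distrib_left coeff_series_def Z_def)
  also have "geom * (\<Sum>k\<le>p + q. fps_const (of_nat k * Ppoly (p + q) p k) * Z k) =
      (\<Sum>r\<le>p. \<Sum>s\<le>q. fps_const (Ind (r + s)) * L r s * coeff_series (p - r) (q - s))"
  proof -
    define U where "U r s k = (\<Sum>j\<le>k. Con (scaled_nbinom r s j) * Ppoly (p - r + (q - s)) (p - r) (k - j))" for r s k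
    have "(\<Sum>k\<le>p + q. fps_const (of_nat k * Ppoly (p + q) p k) * Z k) =
        (\<Sum>k\<le>p + q. fps_const (\<Sum>r\<le>p. \<Sum>s\<le>q. Ind (r + s) * U r s k) * Z k)"
      by (simp only: Ppoly_recurrence U_def sum_distrib_left mult_ac)
    also have "\<dots> = (\<Sum>k\<le>p + q. \<Sum>r\<le>p. \<Sum>s\<le>q. fps_const (Ind (r + s)) * (fps_const (U r s k) * Z k))"
      by (simp only: fps_const_sum fps_const_mult[symmetric] sum_distrib_right mult.assoc)
    also have "\<dots> = (\<Sum>r\<le>p. \<Sum>k\<le>p + q. \<Sum>s\<le>q. fps_const (Ind (r + s)) * (fps_const (U r s k) * Z k))"
      by (rule sum.swap)
    also have "\<dots> = (\<Sum>r\<le>p. \<Sum>s\<le>q. \<Sum>k\<le>p + q. fps_const (Ind (r + s)) * (fps_const (U r s k) * Z k))"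
      by (intro sum.cong[OF refl] sum.swap)
    finally have expand: "(\<Sum>k\<le>p + q. fps_const (of_nat k * Ppoly (p + q) p k) * Z k) =
        (\<Sum>r\<le>p. \<Sum>s\<le>q. \<Sum>k\<le>p + q. fps_const (Ind (r + s)) * (fps_const (U r s k) * Z k))" .
    have "geom * (\<Sum>k\<le>p + q. fps_const (of_nat k * Ppoly (p + q) p k) * Z k) =
        (\<Sum>r\<le>p. \<Sum>s\<le>q. fps_const (Ind (r + s)) * (geom * (\<Sum>k\<le>p + q. fps_const (U r s k) * Z k)))"
      unfolding expand by (simp only: sum_distrib_left mult_ac)
    also have "\<dots> = (\<Sum>r\<le>p. \<Sum>s\<le>q. fps_const (Ind (r + s)) * (L r s * coeff_series (p - r) (q - s)))"
    proof (intro sum.cong[OF refl] arg_cong[of _ _ "(*) _"])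
      fix r s assume "r \<in> {..p}" "s \<in> {..q}"
      then show "geom * (\<Sum>k\<le>p + q. fps_const (U r s k) * Z k) = L r s * coeff_series (p - r) (q - s)"
        using scaled_nbinom_convolution[of r p s q]
        by (simp only: atMost_iff L_def U_def Z_def fps_const_sum sum_distrib_right)
    qed
    finally show ?thesis
      by (simp only: mult.assoc)
  qed
  also have "fps_const (Ind 0) * (geom * fps_X) * coeff_series p q =
      (\<Sum>r\<le>p. \<Sum>s\<le>q. fps_const (Ind (r + s)) * (if r = 0 \<and> s = 0 then geom * fps_X else 0) * coeff_series (p - r) (q - s))"
  proof -
    have "(\<Sum>s\<le>q. fps_const (Ind (r + s)) * (if r = 0 \<and> s = 0 then geom * fps_X else 0) * coeff_series (p - r) (q - s)) =
        (if r = 0 then fps_const (Ind 0) * (geom * fps_X) * coeff_series p q else 0)" for r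
    proof -
      have "(\<Sum>s\<le>q. fps_const (Ind (r + s)) * (if r = 0 \<and> s = 0 then geom * fps_X else 0) * coeff_series (p - r) (q - s)) =
          (\<Sum>s\<le>q. if s = 0 then (if r = 0 then fps_const (Ind 0) * (geom * fps_X) * coeff_series p q else 0) else 0)"
        by (rule sum.cong[OF refl]) auto
      then show ?thesis
        by (simp only: sum.delta finite_atMost atMost_iff zero_le if_True)
    qed
    then show ?thesis
      by (simp only: sum.delta finite_atMost atMost_iff zero_le if_True)
  qed
  finally show ?thesis
    by (simp only: pochhammer_series_eq L_def[symmetric] distrib_left distrib_right sum.distrib)
qed

text \<open>The coefficient of \<open>t\<^sup>n\<close> in \<open>coeff_series_euler\<close> is Newton's recurrence for the right-hand side.\<close>
theorem theorem3p1:
  fixes n :: nat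
  assumes "n \<ge> 1"
  shows "(\<Sum>\<mu>\<in>partitions_of n. const2 (Con (1 / z_part \<mu>)) *
            (\<Prod>k = 1..n.
               series2 (\<lambda>r s. Con (pochhammer (of_nat k) r / fact r * (pochhammer (of_nat k) s / fact s))
                               * Ind (r + s)) ^ count_list \<mu> k))
       = series2 (\<lambda>p q. \<Sum>k = 0..min n (p + q).
            poly_choose (Ind 0 + of_nat n - 1) (n - k) * Ppoly (p + q) p k)"
proof -
  define S where "S k = series2 (\<lambda>r s. Con (pochhammer (of_nat k) r / fact r *
    (pochhammer (of_nat k) s / fact s)) * Ind (r + s))" for k
  define g where "g n = series2 (\<lambda>p q. coeff_series p q $ n)" for n
  have "g n = qpoly2.cycle_index S n"
  proof (rule qpoly2.cycle_index_unique)
    show "g 0 = 1"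
    proof (rule fps2_eqI)
      fix p q
      show "g 0 $ p $ q = 1 $ p $ q"
        by (auto simp: g_def coeff_series_nth poly_choose_0 Ppoly_def)
    qed
    fix n
    show "of_nat n * g n = (\<Sum>k=1..n. S k * g (n - k))"
    proof (rule fps2_eqI)
      fix p q
      have "(of_nat n * g n) $ p $ q = (fps_X * fps_deriv (coeff_series p q)) $ n"
        by (simp add: of_nat_fps2_mult_nth X_deriv_nth g_def)
      also have "\<dots> = (\<Sum>r\<le>p. \<Sum>s\<le>q. Ind (r + s) * (pochhammer_series r s * coeff_series (p - r) (q - s)) $ n)"
        by (simp add: coeff_series_euler fps_sum_nth mult.assoc)
      also have "\<dots> = (\<Sum>r\<le>p. \<Sum>s\<le>q. \<Sum>k=1..n. S k $ r $ s * g (n - k) $ (p - r) $ (q - s))"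
      proof (intro sum.cong[OF refl])
        fix r s
        have "(pochhammer_series r s * coeff_series (p - r) (q - s)) $ n =
            (\<Sum>k=1..n. pochhammer_series r s $ k * coeff_series (p - r) (q - s) $ (n - k))"
          unfolding fps_mult_nth by (rule sum.mono_neutral_right) (auto simp: pochhammer_series_def)
        also have "Ind (r + s) * \<dots> = (\<Sum>k=1..n. S k $ r $ s * g (n - k) $ (p - r) $ (q - s))"
          unfolding sum_distrib_left
          by (intro sum.cong refl) (auto simp: pochhammer_series_def S_def g_def)
        finally show "Ind (r + s) * (pochhammer_series r s * coeff_series (p - r) (q - s)) $ n =
            (\<Sum>k=1..n. S k $ r $ s * g (n - k) $ (p - r) $ (q - s))" .
      qed
      also have "\<dots> = (\<Sum>r\<le>p. \<Sum>k=1..n. \<Sum>s\<le>q. S k $ r $ s * g (n - k) $ (p - r) $ (q - s))"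
        by (intro sum.cong[OF refl] sum.swap)
      also have "\<dots> = (\<Sum>k=1..n. \<Sum>r\<le>p. \<Sum>s\<le>q. S k $ r $ s * g (n - k) $ (p - r) $ (q - s))"
        by (rule sum.swap)
      also have "\<dots> = (\<Sum>k=1..n. S k * g (n - k)) $ p $ q"
        by (simp only: fps_sum_nth fps2_mult_nth)
      finally show "(of_nat n * g n) $ p $ q = (\<Sum>k=1..n. S k * g (n - k)) $ p $ q" .
    qed
  qed
  then show ?thesis
    by (simp only: qpoly2.cycle_index_def S_def g_def coeff_series_nth)
qed

end
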